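(* Let $k,k'$ be nonnegative integers and let $G$ be a finite simple connected graph of order $n$ with minimum degree $\delta(G)\ge k$ and maximum degree $\Delta$, where $\Delta+k'-k\neq 0$. Then $$\gamma_{(k,k',0)}(G)\ \ge\ \frac{k'n}{\Delta+k'-k}.$$
   Context: Let $G$ be a finite simple connected graph with vertex set $V=V(G)$; its order is $n=|V(G)|$. For nonnegative integers $k,k',k''$, a set $S\subseteq V$ is a $(k,k',k'')$-dominating set in $G$ if every vertex in $S$ has at least $k$ neighbors in $S$, and every vertex in $V\setminus S$ has at least $k'$ neighbors in $S$ and at least $k''$ neighbors in $V\setminus S$. The $(k,k',k'')$-domination number $\gamma_{(k,k',k'')}(G)$ is the minimum cardinality of a $(k,k',k'')$-dominating set in $G$ (if $\delta(G)\ge k$, such a set exists, since $S=V(G)$ is one). *)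

theory Defs
  imports Complex_Main "Graph_Theory.Graph_Theory"
begin

text \<open>
  Finite simple graphs are the locale \<^locale>\<open>graph\<close>: finite, loop-free, symmetric digraphs
  without parallel arcs, where each undirected edge is a pair of opposite arcs.
  The degree of a vertex is its \<^const>\<open>out_degree\<close>, justified by \<open>out_degree_eq_card_nbrs\<close> below.
  The name \<open>connected\<close> is qualified since it also denotes the topological notion;
  the graph notion entails that there is at least one vertex.
\<close>

definition nbrs_in :: "('a, 'b) pre_digraph \<Rightarrow> 'a set \<Rightarrow> 'a \<Rightarrow> 'a set" where
  "nbrs_in G S v = {u \<in> S. v \<rightarrow>\<^bsub>G\<^esub> u}"

lemma (in graph) out_degree_eq_card_nbrs:
  "out_degree G v = card (nbrs_in G (verts G) v)"
proof -
  have "nbrs_in G (verts G) v = head G ` out_arcs G v"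
    by (auto simp: nbrs_in_def arcs_ends_conv)
  moreover have "inj_on (head G) (out_arcs G v)"
    by (auto intro!: inj_onI no_multi_arcs simp: arc_to_ends_def)
  ultimately show ?thesis
    by (simp add: out_degree_def card_image)
qed

definition min_degree :: "('a, 'b) pre_digraph \<Rightarrow> nat" where
  "min_degree G = Min (out_degree G ` verts G)"

definition max_degree :: "('a, 'b) pre_digraph \<Rightarrow> nat" where
  "max_degree G = Max (out_degree G ` verts G)"

definition dominating_set ::
    "nat \<Rightarrow> nat \<Rightarrow> nat \<Rightarrow> ('a, 'b) pre_digraph \<Rightarrow> 'a set \<Rightarrow> bool" where
  "dominating_set k k' k'' G S \<longleftrightarrow>
     S \<subseteq> verts G \<and>
     (\<forall>v \<in> S. k \<le> card (nbrs_in G S v)) \<and>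
     (\<forall>v \<in> verts G - S. k' \<le> card (nbrs_in G S v) \<and> k'' \<le> card (nbrs_in G (verts G - S) v))"

text \<open>Meaningful only if some dominating set exists; see \<open>dominating_set_verts\<close>.\<close>

definition domination_number ::
    "nat \<Rightarrow> nat \<Rightarrow> nat \<Rightarrow> ('a, 'b) pre_digraph \<Rightarrow> nat" where
  "domination_number k k' k'' G = Min (card ` {S. dominating_set k k' k'' G S})"

lemma (in graph) dominating_set_verts:
  assumes "k \<le> min_degree G"
  shows "dominating_set k k' k'' G (verts G)"
proof -
  have "k \<le> out_degree G v" if "v \<in> verts G" for v
    using assms that unfolding min_degree_def
    by (meson Min_le finite_imageI finite_verts imageI le_trans)
  then show ?thesis
    by (auto simp: dominating_set_def out_degree_eq_card_nbrs)
qed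

end

theory Submission
  imports Defs
begin

text \<open>
  Write \<open>n\<close>, \<open>\<delta>\<close> and \<open>\<Delta>\<close> for the order and the minimum and maximum degree. Let \<open>S\<close> be a
  dominating set of minimum size and count the edges between \<open>S\<close> and its complement
  from both ends. Each of the \<open>n - card S\<close> outside vertices has at least \<open>k'\<close> neighbours in \<open>S\<close>.
  Each vertex of \<open>S\<close> has at most \<open>\<Delta>\<close> neighbours, of which at least \<open>k\<close> lie in \<open>S\<close>, so at most
  \<open>\<Delta> - k\<close> lie outside. Hence \<open>k' * (n - card S) \<le> (\<Delta> - k) * card S\<close> (\<open>dominating_set_edge_count\<close>), which rearranges to
  \<open>k' * n \<le> (\<Delta> + k' - k) * card S\<close>; the factor \<open>\<Delta> + k' - k\<close> is positive because it is nonzero and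
  \<open>k \<le> \<delta> \<le> \<Delta>\<close>.
\<close>

text \<open>
  Both sides count the pairs of adjacent vertices in \<open>S \<times> T\<close>; adjacency is symmetric.
\<close>

lemma (in graph) sum_card_nbrs_in_swap:
  assumes "finite S" "finite T"
  shows "(\<Sum>v\<in>S. card (nbrs_in G T v)) = (\<Sum>u\<in>T. card (nbrs_in G S u))"
proof -
  have "(\<Sum>v\<in>S. card (nbrs_in G T v)) = (\<Sum>v\<in>S. \<Sum>u | u \<in> T \<and> v \<rightarrow>\<^bsub>G\<^esub> u. 1)"
    by (simp add: nbrs_in_def)
  also have "\<dots> = (\<Sum>u\<in>T. \<Sum>v | v \<in> S \<and> v \<rightarrow>\<^bsub>G\<^esub> u. 1)"
    using assms by (rule sum.swap_restrict)
  also have "\<dots> = (\<Sum>u\<in>T. card (nbrs_in G S u))"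
  proof (rule sum.cong[OF refl])
    fix u
    have "{v \<in> S. v \<rightarrow>\<^bsub>G\<^esub> u} = nbrs_in G S u"
      using sym_arcs by (auto simp: nbrs_in_def symmetric_def dest: symD)
    then show "(\<Sum>v | v \<in> S \<and> v \<rightarrow>\<^bsub>G\<^esub> u. 1) = card (nbrs_in G S u)"
      by simp
  qed
  finally show ?thesis .
qed

lemma (in graph) card_nbrs_in_split_le_max_degree:
  assumes "v \<in> verts G" "S \<subseteq> verts G"
  shows "card (nbrs_in G S v) + card (nbrs_in G (verts G - S) v) \<le> max_degree G"
proof -
  have "finite S" using assms(2) finite_verts by (rule finite_subset)
  have "nbrs_in G (verts G) v = nbrs_in G S v \<union> nbrs_in G (verts G - S) v"
    using assms(2) by (auto simp: nbrs_in_def)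
  moreover have "nbrs_in G S v \<inter> nbrs_in G (verts G - S) v = {}"
    by (auto simp: nbrs_in_def)
  ultimately have "card (nbrs_in G S v) + card (nbrs_in G (verts G - S) v) = out_degree G v"
    using \<open>finite S\<close> by (simp add: out_degree_eq_card_nbrs card_Un_disjoint nbrs_in_def)
  also have "\<dots> \<le> max_degree G"
    unfolding max_degree_def using assms(1) by simp
  finally show ?thesis .
qed

text \<open>
  The double count of the edges leaving \<open>S\<close>, arranged additively: the \<open>k\<close> guaranteed inner
  neighbours are added on the left, which avoids subtracting natural numbers.
\<close>

lemma (in graph) dominating_set_edge_count:
  assumes "dominating_set k k' k'' G S"
  shows "k * card S + k' * card (verts G - S) \<le> max_degree G * card S"
proof -
  have sub: "S \<subseteq> verts G"
    and inner: "\<And>v. v \<in> S \<Longrightarrow> k \<le> card (nbrs_in G S v)"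
    and outer: "\<And>v. v \<in> verts G - S \<Longrightarrow> k' \<le> card (nbrs_in G S v)"
    using assms by (auto simp: dominating_set_def)
  have fin: "finite S" using sub finite_verts by (rule finite_subset)
  have "k' * card (verts G - S) \<le> (\<Sum>u\<in>verts G - S. card (nbrs_in G S u))"
    using sum_mono[of "verts G - S" "\<lambda>_. k'", OF outer] by (simp add: mult.commute)
  also have "\<dots> = (\<Sum>v\<in>S. card (nbrs_in G (verts G - S) v))"
    using fin by (simp add: sum_card_nbrs_in_swap)
  finally have "k * card S + k' * card (verts G - S)
      \<le> (\<Sum>v\<in>S. k) + (\<Sum>v\<in>S. card (nbrs_in G (verts G - S) v))"
    by (simp add: mult.commute)
  also have "\<dots> = (\<Sum>v\<in>S. k + card (nbrs_in G (verts G - S) v))"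
    by (simp add: sum.distrib)
  also have "\<dots> \<le> (\<Sum>v\<in>S. max_degree G)"
  proof (rule sum_mono)
    fix v assume "v \<in> S"
    with sub inner card_nbrs_in_split_le_max_degree[of v S]
    show "k + card (nbrs_in G (verts G - S) v) \<le> max_degree G"
      by fastforce
  qed
  finally show ?thesis by (simp add: mult.commute)
qed

lemma (in graph) min_degree_le_max_degree:
  assumes "verts G \<noteq> {}"
  shows "min_degree G \<le> max_degree G"
  unfolding min_degree_def max_degree_def
  using assms by (meson Max_ge Min_in finite_imageI finite_verts image_is_empty)

text \<open>
  The degree hypothesis makes the whole vertex set dominating, so the minimum in
  \<open>domination_number\<close> ranges over a nonempty set and is attained.
\<close>

lemma (in graph) domination_number_attained:
  assumes "k \<le> min_degree G"
  obtains S where "dominating_set k k' k'' G S" "card S = domination_number k k' k'' G"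
proof -
  let ?D = "{S. dominating_set k k' k'' G S}"
  have "?D \<subseteq> Pow (verts G)" by (auto simp: dominating_set_def)
  then have "finite ?D" by (rule finite_subset) simp
  moreover have "?D \<noteq> {}" using dominating_set_verts[OF assms] by blast
  ultimately have "Min (card ` ?D) \<in> card ` ?D" by (intro Min_in) auto
  then show thesis using that unfolding domination_number_def by force
qed

theorem theorem2p8:
  fixes G :: "('a, 'b) pre_digraph" and k k' :: nat
  assumes "graph G"
    and "Digraph_Component.connected G"
    and "min_degree G \<ge> k"
    and "real (max_degree G) + real k' - real k \<noteq> 0"
  shows "real (domination_number k k' 0 G)
           \<ge> real k' * real (card (verts G)) / (real (max_degree G) + real k' - real k)"
proof -
  interpret graph G by fact
  have "verts G \<noteq> {}"
    using assms(2) by (auto simp: connected_def strongly_connected_def)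
  then have "k \<le> max_degree G"
    using assms(3) min_degree_le_max_degree by linarith
  with assms(4) have pos: "0 < real (max_degree G) + real k' - real k"
    by linarith
  obtain S where S: "dominating_set k k' 0 G S" "card S = domination_number k k' 0 G"
    using domination_number_attained[OF assms(3)] .
  have sub: "S \<subseteq> verts G" using S(1) by (simp add: dominating_set_def)
  then have "card (verts G) = card S + card (verts G - S)"
    by (metis card_Un_disjoint Diff_disjoint Diff_partition finite_Diff finite_subset finite_verts)
  then have "real k' * real (card (verts G)) = real (k' * card (verts G - S)) + real k' * real (card S)"
    by (simp add: algebra_simps)
  also have "\<dots> \<le> real (card S) * (real (max_degree G) + real k' - real k)"
    using of_nat_mono[OF dominating_set_edge_count[OF S(1)], where 'a = real]
    by (simp add: algebra_simps)
  finally show ?thesis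
    using pos S(2) by (simp add: pos_divide_le_eq)
qed

end
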